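(* Let $M$ and $M'$ be embedded para-CR manifolds in $\mathbb R^4$, with ambient coordinates $(x,y,a,b)$ and $(x',y',a',b')$ respectively, and let $F\colon M\to M'$ be a para-CR mapping. Then $F$ extends to a para-holomorphic mapping $\tilde F$ from a neighbourhood of $M$ in $\mathbb R^4$ to a neighbourhood of $M'$ in $\mathbb R^4$.
   Context: All functions and maps are smooth. Let $\mathbb R^4=\mathbb R^2_{xy}\times\mathbb R^2_{ab}$ with coordinates $(x,y)$ and $(a,b)$ on the two factors. An embedded para-CR manifold is a hypersurface $M\subset\mathbb R^4$ given (locally, near the origin) by an equation $y=a+\phi(a,b,x)$ with $\frac{\partial\phi}{\partial a}(0)=0$; the neighbourhood is taken small enough that $1+\frac{\partial \phi}{\partial a}$ does not vanish. It carries the two direction fields $TM\cap T\mathbb R^2_{xy}$ and $TM\cap T\mathbb R^2_{ab}$, spanned in the coordinates $(x,a,b)$ on $M$ by $X=\partial_x$ and $Y=(1+\frac{\partial\phi}{\partial a})\partial_b-\frac{\partial\phi}{\partial b}\partial_a$ respectively; the corresponding vector fields on $M'$ are denoted $X',Y'$. A differentiable mapping $F\colon M\to M'$ is a para-CR mapping if it respects the two direction fields: $dF_p(X_p)=\lambda(p)X'_{F(p)}$ and $dF_p(Y_p)=\mu(p)Y'_{F(p)}$ for all $p\in M$, with non-vanishing functions $\lambda,\mu$. A mapping $\tilde F$ between open subsets of $\mathbb R^4$ is para-holomorphic if its components $x'\circ\tilde F$ and $y'\circ\tilde F$ have vanishing partial derivatives with respect to $a$ and $b$, and its components $a'\circ\tilde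 F$ and $b'\circ\tilde F$ have vanishing partial derivatives with respect to $x$ and $y$ (equivalently, $(x',a')\circ\tilde F$ and $(y',b')\circ\tilde F$ are para-holomorphic functions). *)

theory Defs
  imports "HOL-Analysis.Analysis"
begin

(* C^n and C^infinity maps on an open subset S of a Euclidean space. The total derivative is
   evaluated at a fixed vector v, so that the codomain stays 'b throughout the recursion. *)
primrec higher_differentiable_on ::
  "'a::euclidean_space set \<Rightarrow> ('a \<Rightarrow> 'b::euclidean_space) \<Rightarrow> nat \<Rightarrow> bool" where
  "higher_differentiable_on S f 0 \<longleftrightarrow> continuous_on S f"
| "higher_differentiable_on S f (Suc n) \<longleftrightarrow>
     (\<forall>p\<in>S. f differentiable (at p)) \<and>
     (\<forall>v. higher_differentiable_on S (\<lambda>p. frechet_derivative f (at p) v) n)"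

definition smooth_on :: "'a::euclidean_space set \<Rightarrow> ('a \<Rightarrow> 'b::euclidean_space) \<Rightarrow> bool" where
  "smooth_on S f \<longleftrightarrow> (\<forall>n. higher_differentiable_on S f n)"

(* A point of R^4 = R^2_xy x R^2_ab is written ((x, y), (a, b)); the intrinsic coordinates on a
   hypersurface y = a + phi(a, b, x) are the arguments of phi, in the order (a, b, x). *)
type_synonym R4 = "(real \<times> real) \<times> (real \<times> real)"
type_synonym R3 = "real \<times> real \<times> real"

definition partial_a :: "(R3 \<Rightarrow> real) \<Rightarrow> R3 \<Rightarrow> real" where
  "partial_a \<phi> = (\<lambda>(a, b, x). deriv (\<lambda>t. \<phi> (t, b, x)) a)"

definition partial_b :: "(R3 \<Rightarrow> real) \<Rightarrow> R3 \<Rightarrow> real" where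
  "partial_b \<phi> = (\<lambda>(a, b, x). deriv (\<lambda>t. \<phi> (a, t, x)) b)"

definition embedded_para_CR :: "R3 set \<Rightarrow> (R3 \<Rightarrow> real) \<Rightarrow> bool" where
  "embedded_para_CR U \<phi> \<longleftrightarrow>
     open U \<and> (0, 0, 0) \<in> U \<and> smooth_on U \<phi> \<and> partial_a \<phi> (0, 0, 0) = 0 \<and>
     (\<forall>u\<in>U. 1 + partial_a \<phi> u \<noteq> 0)"

definition hypersurface :: "R3 set \<Rightarrow> (R3 \<Rightarrow> real) \<Rightarrow> R4 set" where
  "hypersurface U \<phi> = {((x, y), (a, b)) | x y a b. (a, b, x) \<in> U \<and> y = a + \<phi> (a, b, x)}"

(* For u in U, param phi u is the point of the hypersurface with coordinates u;
   coords is the inverse of this parametrization and does not depend on phi. *)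
definition param :: "(R3 \<Rightarrow> real) \<Rightarrow> R3 \<Rightarrow> R4" where
  "param \<phi> = (\<lambda>(a, b, x). ((x, a + \<phi> (a, b, x)), (a, b)))"

definition coords :: "R4 \<Rightarrow> R3" where
  "coords = (\<lambda>((x, y), (a, b)). (a, b, x))"

(* X = d/dx and Y = (1 + phi_a) d/db - phi_b d/da, as vectors in the coordinates (a, b, x);
   X spans TM \<inter> T R^2_xy and Y spans TM \<inter> T R^2_ab. *)
definition field_X :: "(R3 \<Rightarrow> real) \<Rightarrow> R3 \<Rightarrow> R3" where
  "field_X \<phi> u = (0, 0, 1)"

definition field_Y :: "(R3 \<Rightarrow> real) \<Rightarrow> R3 \<Rightarrow> R3" where
  "field_Y \<phi> u = (- partial_b \<phi> u, 1 + partial_a \<phi> u, 0)"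

(* Only the values of F on the hypersurface over U matter. Smoothness of F, its differential and
   the factors l, m are expressed in the coordinates of source and target. *)
definition para_CR_map ::
  "R3 set \<Rightarrow> (R3 \<Rightarrow> real) \<Rightarrow> R3 set \<Rightarrow> (R3 \<Rightarrow> real) \<Rightarrow> (R4 \<Rightarrow> R4) \<Rightarrow> bool" where
  "para_CR_map U \<phi> U' \<phi>' F \<longleftrightarrow>
     F ` hypersurface U \<phi> \<subseteq> hypersurface U' \<phi>' \<and>
     smooth_on U (coords \<circ> F \<circ> param \<phi>) \<and>
     (\<exists>l m :: R3 \<Rightarrow> real. smooth_on U l \<and> smooth_on U m \<and>
       (\<forall>u\<in>U. l u \<noteq> 0 \<and> m u \<noteq> 0 \<and>
         frechet_derivative (coords \<circ> F \<circ> param \<phi>) (at u) (field_X \<phi> u)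
           = l u *\<^sub>R field_X \<phi>' (coords (F (param \<phi> u))) \<and>
         frechet_derivative (coords \<circ> F \<circ> param \<phi>) (at u) (field_Y \<phi> u)
           = m u *\<^sub>R field_Y \<phi>' (coords (F (param \<phi> u)))))"

(* fst and snd of a value are the component pairs (x', y') and (a', b'). Vanishing of partial
   derivatives is local: on an N that is not a product it does not force F to be a product map. *)
definition para_holomorphic :: "R4 set \<Rightarrow> R4 set \<Rightarrow> (R4 \<Rightarrow> R4) \<Rightarrow> bool" where
  "para_holomorphic N N' F \<longleftrightarrow>
     open N \<and> open N' \<and> F ` N \<subseteq> N' \<and> smooth_on N F \<and>
     (\<forall>x y a b. ((x, y), (a, b)) \<in> N \<longrightarrow>
        ((\<lambda>t. fst (F ((x, y), (t, b)))) has_vector_derivative 0) (at a) \<and>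
        ((\<lambda>t. fst (F ((x, y), (a, t)))) has_vector_derivative 0) (at b) \<and>
        ((\<lambda>t. snd (F ((t, y), (a, b)))) has_vector_derivative 0) (at x) \<and>
        ((\<lambda>t. snd (F ((x, t), (a, b)))) has_vector_derivative 0) (at y))"

end

theory Submission
  imports Defs
begin

text \<open>In the coordinates \<open>(a, b, x)\<close> on \<open>M\<close> the components \<open>x', y'\<close> of \<open>F\<close> are annihilated by \<open>Y\<close>
  and \<open>a', b'\<close> by \<open>X\<close>. Hence \<open>a', b'\<close>, regarded as functions of \<open>(x, y, a, b)\<close> not involving
  \<open>y\<close>, already extend as required. To extend \<open>x', y'\<close>, slide \<open>(x, y, a, b)\<close> in the
  \<open>a\<close>-direction until it hits \<open>M\<close>. Since \<open>1 + \<phi>\<^sub>a\<close> does not vanish, Rolle's theorem makes the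
  foot point unique among those reached without leaving \<open>U\<close>. The inverse of sliding, \<open>(x, s, a, b)\<close>
  to \<open>(x, s + \<phi>(s, b, x), a, b)\<close>, is then an injective local diffeomorphism, so the set of
  admissible points is open by invariance of domain and the foot point depends smoothly on
  the point. When \<open>a\<close> varies the foot point is fixed, and when \<open>b\<close> varies it moves along \<open>Y\<close>.\<close>

section \<open>Calculus of smooth maps\<close>

text \<open>On an open set a derivative depends only on nearby values, so agreement on
  \<open>S\<close> passes to \<open>frechet_derivative\<close> and from there to all orders.\<close>

lemma higher_differentiable_on_cong:
  assumes "open S" "\<And>p. p \<in> S \<Longrightarrow> f p = g p" "higher_differentiable_on S f n"
  shows "higher_differentiable_on S g n"
  using assms(2,3)
proof (induction n arbitrary: f g)
  case 0
  then show ?case using continuous_on_cong by (metis higher_differentiable_on.simps(1))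
next
  case (Suc n)
  have D: "(g has_derivative frechet_derivative f (at p)) (at p)" if "p \<in> S" for p
  proof (rule has_derivative_transform_within_open)
    show "(f has_derivative frechet_derivative f (at p)) (at p)"
      using Suc.prems(2) that frechet_derivative_works by (metis higher_differentiable_on.simps(2))
  qed (use Suc.prems(1) assms(1) that in auto)
  have eq: "frechet_derivative f (at p) v = frechet_derivative g (at p) v" if "p \<in> S" for p v
    using frechet_derivative_at[OF D[OF that]] by simp
  have "higher_differentiable_on S (\<lambda>p. frechet_derivative g (at p) v) n" for v
    by (rule Suc.IH[where f = "\<lambda>p. frechet_derivative f (at p) v"]) (use eq Suc.prems(2) in auto)
  with D show ?case by (auto simp: differentiable_def)
qed

text \<open>By uniqueness of the derivative an explicit formula \<open>D\<close> may stand in for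
  \<open>frechet_derivative\<close>. The inductive steps of the closure properties rest on
  this.\<close>

lemma higher_differentiable_on_SucI:
  assumes "open S" "\<And>p. p \<in> S \<Longrightarrow> (f has_derivative D p) (at p)"
    and "\<And>v. higher_differentiable_on S (\<lambda>p. D p v) n"
  shows "higher_differentiable_on S f (Suc n)"
proof -
  have eq: "D p v = frechet_derivative f (at p) v" if "p \<in> S" for p v
    using frechet_derivative_at[OF assms(2)[OF that]] by simp
  have "higher_differentiable_on S (\<lambda>p. frechet_derivative f (at p) v) n" for v
    by (rule higher_differentiable_on_cong[OF assms(1) _ assms(3)]) (use eq in auto)
  with assms(2) show ?thesis by (auto simp: differentiable_def)
qed

lemma higher_differentiable_on_has_derivative:
  "higher_differentiable_on S f (Suc n) \<Longrightarrow> p \<in> S \<Longrightarrow>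
    (f has_derivative frechet_derivative f (at p)) (at p)"
  using frechet_derivative_works by auto

lemma higher_differentiable_on_SucD:
  "higher_differentiable_on S f (Suc n) \<Longrightarrow> higher_differentiable_on S f n"
proof (induction n arbitrary: f)
  case 0
  then show ?case
    by (auto intro!: differentiable_imp_continuous_on differentiable_at_imp_differentiable_on)
next
  case (Suc n)
  then show ?case using higher_differentiable_on.simps(2) by metis
qed

section \<open>Closure properties of C^n maps\<close>

lemma higher_differentiable_on_const:
  "open S \<Longrightarrow> higher_differentiable_on S (\<lambda>p. c) n"
proof (induction n arbitrary: c)
  case (Suc n)
  show ?case
    by (rule higher_differentiable_on_SucI[where D = "\<lambda>p v. 0"]) (use Suc in auto)
qed simp

lemma higher_differentiable_on_bounded_linear:
  assumes "bounded_linear L" "open S"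
  shows "higher_differentiable_on S f n \<Longrightarrow> higher_differentiable_on S (\<lambda>p. L (f p)) n"
proof (induction n arbitrary: f)
  case 0
  then show ?case using assms bounded_linear.continuous_on by fastforce
next
  case (Suc n)
  show ?case
    by (rule higher_differentiable_on_SucI[OF assms(2),
          where D = "\<lambda>p v. L (frechet_derivative f (at p) v)"])
       (use Suc assms(1) higher_differentiable_on_has_derivative[OF Suc.prems] in
         \<open>auto intro: bounded_linear.has_derivative\<close>)
qed

lemma higher_differentiable_on_id:
  assumes "open S"
  shows "higher_differentiable_on S (\<lambda>p. p) n"
proof (cases n)
  case (Suc m)
  show ?thesis unfolding Suc
    by (rule higher_differentiable_on_SucI[where D = "\<lambda>p v. v"])
       (use assms higher_differentiable_on_const in auto)
qed auto

lemma higher_differentiable_on_add: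
  assumes "open S"
  shows "higher_differentiable_on S f n \<Longrightarrow> higher_differentiable_on S g n \<Longrightarrow>
    higher_differentiable_on S (\<lambda>p. f p + g p) n"
proof (induction n arbitrary: f g)
  case (Suc n)
  show ?case
    by (rule higher_differentiable_on_SucI[OF assms,
          where D = "\<lambda>p v. frechet_derivative f (at p) v + frechet_derivative g (at p) v"])
       (use Suc higher_differentiable_on_has_derivative[OF Suc.prems(1)]
         higher_differentiable_on_has_derivative[OF Suc.prems(2)] in \<open>auto intro: has_derivative_add\<close>)
qed (auto intro: continuous_on_add)

lemma higher_differentiable_on_sum:
  assumes "open S" "finite I"
    and "\<And>i. i \<in> I \<Longrightarrow> higher_differentiable_on S (f i) n"
  shows "higher_differentiable_on S (\<lambda>p. \<Sum>i\<in>I. f i p) n"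
  using assms(2,3)
  by (induction rule: finite_induct)
     (auto intro: higher_differentiable_on_add higher_differentiable_on_const assms(1))

lemma higher_differentiable_on_Pair:
  assumes "open S"
    and f: "higher_differentiable_on S f n" and g: "higher_differentiable_on S g n"
  shows "higher_differentiable_on S (\<lambda>p. (f p, g p)) n"
proof -
  \<comment> \<open>A pair is the sum of the images of its components under the two linear
    inclusions.\<close>
  have "higher_differentiable_on S (\<lambda>p. (f p, 0) + (0, g p)) n"
    by (intro higher_differentiable_on_add
        higher_differentiable_on_bounded_linear[OF _ assms(1) f]
        higher_differentiable_on_bounded_linear[OF _ assms(1) g] assms(1)
        bounded_linear_Pair bounded_linear_ident bounded_linear_zero)
  then show ?thesis by simp
qed

lemma higher_differentiable_on_bounded_bilinear:
  assumes "bounded_bilinear h" "open S"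
  shows "higher_differentiable_on S f n \<Longrightarrow> higher_differentiable_on S g n \<Longrightarrow>
    higher_differentiable_on S (\<lambda>p. h (f p) (g p)) n"
proof (induction n arbitrary: f g)
  case 0
  then show ?case using assms bounded_bilinear.continuous_on by fastforce
next
  case (Suc n)
  note D = higher_differentiable_on_has_derivative[OF Suc.prems(1)]
    higher_differentiable_on_has_derivative[OF Suc.prems(2)]
  show ?case
  proof (rule higher_differentiable_on_SucI[OF assms(2)])
    show "((\<lambda>p. h (f p) (g p)) has_derivative
      (\<lambda>v. h (f p) (frechet_derivative g (at p) v) + h (frechet_derivative f (at p) v) (g p))) (at p)"
      if "p \<in> S" for p
      using bounded_bilinear.FDERIV[OF assms(1)] D that by blast
    show "higher_differentiable_on S (\<lambda>p. h (f p) (frechet_derivative g (at p) v) +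
        h (frechet_derivative f (at p) v) (g p)) n" for v
      using Suc higher_differentiable_on_SucD[OF Suc.prems(1)]
        higher_differentiable_on_SucD[OF Suc.prems(2)]
      by (intro higher_differentiable_on_add Suc.IH assms(2)) auto
  qed
qed

lemma higher_differentiable_on_mult:
  fixes f g :: "'a::euclidean_space \<Rightarrow> real"
  shows "open S \<Longrightarrow> higher_differentiable_on S f n \<Longrightarrow> higher_differentiable_on S g n \<Longrightarrow>
    higher_differentiable_on S (\<lambda>p. f p * g p) n"
  by (rule higher_differentiable_on_bounded_bilinear[OF bounded_bilinear_mult])

text \<open>The derivative of the reciprocal is a product of the reciprocal itself and the
  derivative of \<open>f\<close>, so the induction hypothesis applies to its own derivative.\<close>

lemma higher_differentiable_on_inverse:
  fixes f :: "'a::euclidean_space \<Rightarrow> real"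
  assumes "open S" "\<And>p. p \<in> S \<Longrightarrow> f p \<noteq> 0"
  shows "higher_differentiable_on S f n \<Longrightarrow> higher_differentiable_on S (\<lambda>p. inverse (f p)) n"
proof (induction n)
  case 0
  then show ?case using assms by (auto intro: continuous_on_inverse)
next
  case (Suc n)
  note inv = Suc.IH[OF higher_differentiable_on_SucD[OF Suc.prems]]
  show ?case
  proof (rule higher_differentiable_on_SucI[OF assms(1)])
    show "((\<lambda>p. inverse (f p)) has_derivative
        (\<lambda>v. - (inverse (f p) * frechet_derivative f (at p) v * inverse (f p)))) (at p)"
      if "p \<in> S" for p
      using Deriv.has_derivative_inverse[OF assms(2)[OF that]
          higher_differentiable_on_has_derivative[OF Suc.prems that]] .
    show "higher_differentiable_on S
        (\<lambda>p. - (inverse (f p) * frechet_derivative f (at p) v * inverse (f p))) n" for v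
      using inv Suc.prems
      by (intro higher_differentiable_on_bounded_linear[OF bounded_linear_minus[OF bounded_linear_ident]]
          higher_differentiable_on_mult assms(1)) auto
  qed
qed

lemma higher_differentiable_on_compose:
  fixes f :: "'a::euclidean_space \<Rightarrow> 'b::euclidean_space" and g :: "'b \<Rightarrow> 'c::euclidean_space"
  assumes "open S" "f ` S \<subseteq> T"
  shows "higher_differentiable_on T g n \<Longrightarrow> higher_differentiable_on S f n \<Longrightarrow>
    higher_differentiable_on S (\<lambda>p. g (f p)) n"
proof (induction n arbitrary: g)
  case 0
  then show ?case using assms continuous_on_compose2[of T g S f] by auto
next
  case (Suc n)
  let ?g' = "\<lambda>p. frechet_derivative g (at (f p))" and ?f' = "\<lambda>p. frechet_derivative f (at p)"
  have Dg: "(g has_derivative ?g' p) (at (f p))" if "p \<in> S" for p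
    using higher_differentiable_on_has_derivative[OF Suc.prems(1)] that assms(2) by auto
  show ?case
  proof (rule higher_differentiable_on_SucI[OF assms(1)])
    fix p assume p: "p \<in> S"
    interpret g': bounded_linear "?g' p" using Dg[OF p] by (rule has_derivative_bounded_linear)
    have "((\<lambda>p. g (f p)) has_derivative (\<lambda>v. ?g' p (?f' p v))) (at p)"
      using has_derivative_compose[OF higher_differentiable_on_has_derivative[OF Suc.prems(2) p] Dg[OF p]] .
    \<comment> \<open>\<open>higher_differentiable_on\<close> controls \<open>?g' p\<close> only at
      fixed vectors, while \<open>?f' p v\<close> varies with \<open>p\<close>. Expanding in the
      basis separates the two.\<close>
    moreover have "?g' p (?f' p v) = (\<Sum>i\<in>Basis. (?f' p v \<bullet> i) *\<^sub>R ?g' p i)" for v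
      by (metis (no_types, lifting) euclidean_representation g'.scaleR g'.sum sum.cong)
    ultimately show "((\<lambda>p. g (f p)) has_derivative
        (\<lambda>v. \<Sum>i\<in>Basis. (?f' p v \<bullet> i) *\<^sub>R ?g' p i)) (at p)" by simp
  next
    fix v
    show "higher_differentiable_on S (\<lambda>p. \<Sum>i\<in>Basis. (?f' p v \<bullet> i) *\<^sub>R ?g' p i) n"
    proof (rule higher_differentiable_on_sum[OF assms(1) finite_Basis])
      fix i :: 'b
      have "higher_differentiable_on S (\<lambda>p. ?f' p v \<bullet> i) n"
        by (rule higher_differentiable_on_bounded_linear[OF bounded_linear_inner_left assms(1)])
           (use Suc.prems(2) in simp)
      \<comment> \<open>The induction hypothesis is applied with the derivative of \<open>g\<close>
        in direction \<open>i\<close> as the new outer function.\<close>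
      moreover have "higher_differentiable_on S (\<lambda>p. ?g' p i) n"
        by (rule Suc.IH[OF _ higher_differentiable_on_SucD[OF Suc.prems(2)]])
           (use Suc.prems(1) in simp)
      ultimately show "higher_differentiable_on S (\<lambda>p. (?f' p v \<bullet> i) *\<^sub>R ?g' p i) n"
        by (rule higher_differentiable_on_bounded_bilinear[OF bounded_bilinear_scaleR assms(1)])
    qed
  qed
qed

text \<open>Bootstrapping: the derivative of \<open>g\<close> at \<open>p\<close> is a smooth
  function of the value \<open>g p\<close>, as for an inverse function. If \<open>g\<close> is C^n,
  so is its derivative by composition, hence \<open>g\<close> is C^(n+1).\<close>

lemma smooth_on_inverse_function:
  fixes g :: "'a::euclidean_space \<Rightarrow> 'b::euclidean_space"
  assumes "open V" "g ` V \<subseteq> E"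
    and "\<And>p. p \<in> V \<Longrightarrow> (g has_derivative g' (g p)) (at p)"
    and "\<And>v. smooth_on E (\<lambda>r. g' r v)"
  shows "smooth_on V g"
proof -
  have "higher_differentiable_on V g n" for n
  proof (induction n)
    case 0
    have "isCont g p" if "p \<in> V" for p
      using has_derivative_continuous[OF assms(3)[OF that]] .
    then show ?case by (simp add: continuous_at_imp_continuous_on)
  next
    case (Suc n)
    show ?case
    proof (rule higher_differentiable_on_SucI[OF assms(1,3)])
      show "higher_differentiable_on V (\<lambda>p. g' (g p) v) n" for v
        by (rule higher_differentiable_on_compose[OF assms(1,2) _ Suc])
           (use assms(4) in \<open>simp add: smooth_on_def\<close>)
    qed
  qed
  then show ?thesis by (simp add: smooth_on_def)
qed

section \<open>From C^n to smooth maps\<close>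

lemma smooth_on_has_derivative:
  "smooth_on S f \<Longrightarrow> p \<in> S \<Longrightarrow> (f has_derivative frechet_derivative f (at p)) (at p)"
  unfolding smooth_on_def using higher_differentiable_on_has_derivative by blast

lemma smooth_on_frechet_derivative:
  "smooth_on S f \<Longrightarrow> smooth_on S (\<lambda>p. frechet_derivative f (at p) v)"
  unfolding smooth_on_def using higher_differentiable_on.simps(2) by blast

lemma smooth_on_const: "open S \<Longrightarrow> smooth_on S (\<lambda>p. c)"
  by (simp add: smooth_on_def higher_differentiable_on_const)

lemma smooth_on_linear:
  "bounded_linear L \<Longrightarrow> open S \<Longrightarrow> smooth_on S L"
  using higher_differentiable_on_bounded_linear[OF _ _ higher_differentiable_on_id]
  by (auto simp: smooth_on_def)

lemma smooth_on_add:
  "open S \<Longrightarrow> smooth_on S f \<Longrightarrow> smooth_on S g \<Longrightarrow> smooth_on S (\<lambda>p. f p + g p)"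
  by (simp add: smooth_on_def higher_differentiable_on_add del: higher_differentiable_on.simps)

lemma smooth_on_mult:
  fixes f g :: "'a::euclidean_space \<Rightarrow> real"
  shows "open S \<Longrightarrow> smooth_on S f \<Longrightarrow> smooth_on S g \<Longrightarrow> smooth_on S (\<lambda>p. f p * g p)"
  by (simp add: smooth_on_def higher_differentiable_on_mult)

lemma smooth_on_inverse:
  fixes f :: "'a::euclidean_space \<Rightarrow> real"
  shows "open S \<Longrightarrow> smooth_on S f \<Longrightarrow> (\<And>p. p \<in> S \<Longrightarrow> f p \<noteq> 0) \<Longrightarrow> smooth_on S (\<lambda>p. inverse (f p))"
  by (simp add: smooth_on_def higher_differentiable_on_inverse)

lemma smooth_on_Pair:
  "open S \<Longrightarrow> smooth_on S f \<Longrightarrow> smooth_on S g \<Longrightarrow> smooth_on S (\<lambda>p. (f p, g p))"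
  by (simp add: smooth_on_def higher_differentiable_on_Pair)

lemma smooth_on_compose:
  "open S \<Longrightarrow> smooth_on T g \<Longrightarrow> smooth_on S f \<Longrightarrow> f ` S \<subseteq> T \<Longrightarrow> smooth_on S (\<lambda>p. g (f p))"
  using higher_differentiable_on_compose unfolding smooth_on_def by blast

text \<open>A segment is compact, so \<open>U\<close> contains a uniform
  \<open>e\<close>-neighbourhood of it. Moving both endpoints by less than \<open>e\<close> moves
  each point of the segment, at equal parameter, by less than \<open>e\<close>.\<close>

lemma open_closed_segment_subset:
  fixes U :: "'a::euclidean_space set"
  assumes "open U"
  shows "open {(p, q). closed_segment p q \<subseteq> U}"
  unfolding open_dist
proof (safe)
  fix p q :: 'a assume "closed_segment p q \<subseteq> U"
  then obtain e where e: "e > 0" "(\<Union>x\<in>closed_segment p q. ball x e) \<subseteq> U"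
    using compact_subset_open_imp_ball_epsilon_subset[OF compact_segment assms] by metis
  have "closed_segment p' q' \<subseteq> U" if d: "dist (p', q') (p, q) < e" for p' q'
  proof
    fix z assume "z \<in> closed_segment p' q'"
    then obtain t where t: "0 \<le> t" "t \<le> 1" "z = (1 - t) *\<^sub>R p' + t *\<^sub>R q'"
      by (auto simp: in_segment)
    define w where "w = (1 - t) *\<^sub>R p + t *\<^sub>R q"
    have pq: "norm (p - p') < e" "norm (q - q') < e"
      using d dist_fst_le[of "(p', q')" "(p, q)"] dist_snd_le[of "(p', q')" "(p, q)"]
      by (auto simp: dist_norm norm_minus_commute)
    have "w - z = (1 - t) *\<^sub>R (p - p') + t *\<^sub>R (q - q')"
      by (simp add: w_def t algebra_simps)
    also have "norm \<dots> \<le> (1 - t) * norm (p - p') + t * norm (q - q')"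
      using norm_triangle_ineq t by (metis (no_types, lifting) abs_of_nonneg diff_ge_0_iff_ge norm_scaleR)
    also have "\<dots> < e"
      using convex_bound_lt[OF pq, of "1 - t" t] t by simp
    finally have "z \<in> ball w e" by (simp add: dist_norm)
    moreover have "w \<in> closed_segment p q" using t by (auto simp: w_def in_segment)
    ultimately show "z \<in> U" using e(2) by blast
  qed
  then show "\<exists>e>0. \<forall>y. dist y (p, q) < e \<longrightarrow> y \<in> {(p, q). closed_segment p q \<subseteq> U}"
    using e(1) by auto
qed

section \<open>Sliding points onto the hypersurface\<close>

locale para_CR =
  fixes U :: "R3 set" and \<phi> :: "R3 \<Rightarrow> real"
  assumes para_CR: "embedded_para_CR U \<phi>"
begin

section \<open>Derivatives of \<phi> and the parametrization of the hypersurface\<close>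

lemma open_U: "open U" and smooth_\<phi>: "smooth_on U \<phi>"
  using para_CR by (auto simp: embedded_para_CR_def)

abbreviation D\<phi> :: "R3 \<Rightarrow> R3 \<Rightarrow> real" where
  "D\<phi> u \<equiv> frechet_derivative \<phi> (at u)"

lemma has_derivative_\<phi>: "u \<in> U \<Longrightarrow> (\<phi> has_derivative D\<phi> u) (at u)"
  using smooth_on_has_derivative[OF smooth_\<phi>] .

lemma linear_D\<phi>: "u \<in> U \<Longrightarrow> linear (D\<phi> u)"
  using has_derivative_\<phi> has_derivative_linear by blast

lemma D\<phi>_first:
  assumes "u \<in> U"
  shows "D\<phi> u (s, v) = s * D\<phi> u (1, 0, 0) + D\<phi> u (0, v)"
proof -
  interpret linear "D\<phi> u" by (rule linear_D\<phi>[OF assms])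
  have "(s, v) = s *\<^sub>R (1, 0, 0) + (0, v)" by (cases v) simp
  then show ?thesis by (metis add scaleR real_scaleR_def)
qed

lemma deriv_first:
  assumes "(a, b, x) \<in> U"
  shows "((\<lambda>t. \<phi> (t, b, x)) has_field_derivative D\<phi> (a, b, x) (1, 0, 0)) (at a)"
proof -
  have "((\<lambda>t. \<phi> (t, b, x)) has_derivative (\<lambda>h. D\<phi> (a, b, x) (h, 0, 0))) (at a)"
    by (rule has_derivative_compose[where f = "\<lambda>t. (t, b, x)", OF _ has_derivative_\<phi>[OF assms]])
       (auto intro!: derivative_eq_intros simp: zero_prod_def)
  moreover have "(\<lambda>h. D\<phi> (a, b, x) (h, 0, 0)) = (*) (D\<phi> (a, b, x) (1, 0, 0))"
  proof
    show "D\<phi> (a, b, x) (h, 0, 0) = D\<phi> (a, b, x) (1, 0, 0) * h" for h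
      using D\<phi>_first[OF assms, of h "(0, 0)"] linear_0[OF linear_D\<phi>[OF assms]]
      by (simp add: zero_prod_def)
  qed
  ultimately show ?thesis by (simp only: has_field_derivative_def)
qed

lemma partial_a_eq: "u \<in> U \<Longrightarrow> partial_a \<phi> u = D\<phi> u (1, 0, 0)"
  by (cases u) (simp add: partial_a_def DERIV_imp_deriv[OF deriv_first])

lemma partial_b_eq:
  assumes "u \<in> U"
  shows "partial_b \<phi> u = D\<phi> u (0, 1, 0)"
proof -
  obtain a b x where u: "u = (a, b, x)" by (cases u)
  interpret linear "D\<phi> u" by (rule linear_D\<phi>[OF assms])
  have "((\<lambda>t. \<phi> (a, t, x)) has_derivative (\<lambda>h. D\<phi> u (0, h, 0))) (at b)"
    unfolding u
    by (rule has_derivative_compose[where f = "\<lambda>t. (a, t, x)", OF _ has_derivative_\<phi>[OF assms[unfolded u]]])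
       (auto intro!: derivative_eq_intros simp: zero_prod_def)
  moreover have "(\<lambda>h. D\<phi> u (0, h, 0)) = (*) (D\<phi> u (0, 1, 0))"
  proof
    show "D\<phi> u (0, h, 0) = D\<phi> u (0, 1, 0) * h" for h
      using scaleR[of h "(0, 1, 0)"] by simp
  qed
  ultimately have "((\<lambda>t. \<phi> (a, t, x)) has_field_derivative D\<phi> u (0, 1, 0)) (at b)"
    by (simp only: has_field_derivative_def)
  then show ?thesis by (simp add: u partial_b_def DERIV_imp_deriv)
qed

lemma nonvanishing: "u \<in> U \<Longrightarrow> 1 + D\<phi> u (1, 0, 0) \<noteq> 0"
  using para_CR partial_a_eq unfolding embedded_para_CR_def by metis

text \<open>The left side is the derivative along \<open>Y\<close> of the ambient coordinate y = a +
  \<phi>. The two terms containing the product of the partial derivatives of \<phi> cancel.\<close>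

lemma D\<phi>_field_Y:
  assumes "u \<in> U"
  shows "fst (field_Y \<phi> u) + D\<phi> u (field_Y \<phi> u) = 0"
proof -
  interpret linear "D\<phi> u" by (rule linear_D\<phi>[OF assms])
  have "D\<phi> u (0, 1 + partial_a \<phi> u, 0) = D\<phi> u (0, 1, 0) * (1 + partial_a \<phi> u)"
    using scaleR[of "1 + partial_a \<phi> u" "(0, 1, 0)"] by simp
  then show ?thesis
    using D\<phi>_first[OF assms, of "- partial_b \<phi> u" "(1 + partial_a \<phi> u, 0)"] assms
    by (simp add: field_Y_def partial_a_eq partial_b_eq algebra_simps)
qed

lemma param_has_derivative:
  assumes "u \<in> U"
  shows "(param \<phi> has_derivative
    (\<lambda>v. ((snd (snd v), fst v + D\<phi> u v), (fst v, fst (snd v))))) (at u)"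
proof -
  have "param \<phi> = (\<lambda>u. ((snd (snd u), fst u + \<phi> u), (fst u, fst (snd u))))"
    by (auto simp: param_def fun_eq_iff)
  then show ?thesis
    using has_derivative_\<phi>[OF assms] by (auto intro!: derivative_eq_intros)
qed

lemma smooth_param: "smooth_on U (param \<phi>)"
proof -
  have "param \<phi> = (\<lambda>u. ((snd (snd u), fst u + \<phi> u), (fst u, fst (snd u))))"
    by (auto simp: param_def fun_eq_iff)
  moreover have "smooth_on U (\<lambda>u::R3. fst u)" "smooth_on U (\<lambda>u::R3. fst (snd u))"
    "smooth_on U (\<lambda>u::R3. snd (snd u))"
    by (intro smooth_on_linear open_U bounded_linear_fst_comp bounded_linear_snd_comp
        bounded_linear_ident)+
  then have "smooth_on U (\<lambda>u. ((snd (snd u), fst u + \<phi> u), (fst u, fst (snd u))))"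
    by (intro smooth_on_Pair smooth_on_add open_U smooth_\<phi>)
  ultimately show ?thesis by simp
qed

lemma param_coords: "p \<in> hypersurface U \<phi> \<Longrightarrow> param \<phi> (coords p) = p"
  and coords_in_U: "p \<in> hypersurface U \<phi> \<Longrightarrow> coords p \<in> U"
  by (auto simp: hypersurface_def param_def coords_def)

lemma param_in_hypersurface: "u \<in> U \<Longrightarrow> param \<phi> u \<in> hypersurface U \<phi>"
  by (cases u) (auto simp: hypersurface_def param_def)

text \<open>A point \<open>((x, s), (a, b))\<close> of the following domain is sent to \<open>((x, y), (a, b))\<close>, where
  \<open>(s, b, x)\<close> are the coordinates of the point of the hypersurface obtained by sliding
  \<open>((x, y), (a, b))\<close> in the \<open>a\<close>-direction. Admitting only slides along which the segment
  stays in \<open>U\<close> makes the map injective, although \<open>U\<close> need not be a product.\<close>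

definition foot :: "R4 \<Rightarrow> R3" where
  "foot r = (snd (fst r), snd (snd r), fst (fst r))"

definition slide_dom :: "R4 set" where
  "slide_dom = {r. closed_segment (coords r) (foot r) \<subseteq> U}"

definition slide :: "R4 \<Rightarrow> R4" where
  "slide r = ((fst (fst r), snd (fst r) + \<phi> (foot r)), snd r)"

definition unslide :: "R4 \<Rightarrow> R4" where
  "unslide = inv_into slide_dom slide"

text \<open>The inverse of the differential of \<open>slide\<close> at \<open>r\<close>, found by
  solving its second component for the increment of s. It depends on the preimage \<open>r\<close>,
  as \<open>smooth_on_inverse_function\<close> requires, and is written with \<open>+ -\<close> and
  \<open>* inverse\<close> to fit the closure rules.\<close>

definition unslide_deriv :: "R4 \<Rightarrow> R4 \<Rightarrow> R4" where
  "unslide_deriv r v =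
    ((fst (fst v), (snd (fst v) + - D\<phi> (foot r) (0, snd (snd v), fst (fst v)))
        * inverse (1 + D\<phi> (foot r) (1, 0, 0))), snd v)"

section \<open>Sliding is an injective open map\<close>

lemma bounded_linear_foot: "bounded_linear foot"
  unfolding foot_def[abs_def]
  by (intro bounded_linear_Pair bounded_linear_fst_comp bounded_linear_snd_comp
      bounded_linear_ident)

lemma coords_eq: "coords = (\<lambda>r. (fst (snd r), snd (snd r), fst (fst r)))"
  by (auto simp: coords_def fun_eq_iff)

lemma bounded_linear_coords: "bounded_linear coords"
  unfolding coords_eq
  by (intro bounded_linear_Pair bounded_linear_fst_comp bounded_linear_snd_comp
      bounded_linear_ident)

lemma open_slide_dom: "open slide_dom"
proof -
  have "slide_dom = (\<lambda>r. (coords r, foot r)) -` {(p, q). closed_segment p q \<subseteq> U}"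
    by (auto simp: slide_dom_def)
  moreover have "continuous_on UNIV (\<lambda>r. (coords r, foot r))"
    by (intro continuous_on_Pair linear_continuous_on bounded_linear_coords bounded_linear_foot)
  ultimately show ?thesis
    by (simp only: open_vimage[OF open_closed_segment_subset[OF open_U]])
qed

lemma foot_in_U: "r \<in> slide_dom \<Longrightarrow> foot r \<in> U"
  and slide_dom_coords_in_U: "r \<in> slide_dom \<Longrightarrow> coords r \<in> U"
  unfolding slide_dom_def using ends_in_segment by blast+

lemma slide_has_derivative:
  assumes "r \<in> slide_dom"
  shows "(slide has_derivative
    (\<lambda>v. ((fst (fst v), snd (fst v) + D\<phi> (foot r) (foot v)), snd v))) (at r)"
proof -
  have "((\<lambda>r. \<phi> (foot r)) has_derivative (\<lambda>v. D\<phi> (foot r) (foot v))) (at r)"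
    using has_derivative_compose[OF bounded_linear_imp_has_derivative[OF bounded_linear_foot]
        has_derivative_\<phi>[OF foot_in_U[OF assms]]] .
  then show ?thesis
    unfolding slide_def[abs_def] by (auto intro!: derivative_eq_intros)
qed

text \<open>Equal values at \<open>s\<close> and \<open>t\<close> would, by the mean value theorem,
  force 1 + \<phi>_a to vanish somewhere between them.\<close>

lemma slide_inj_aux:
  assumes "s < t" and seg: "\<And>z. s \<le> z \<Longrightarrow> z \<le> t \<Longrightarrow> (z, b, x) \<in> U"
  shows "s + \<phi> (s, b, x) \<noteq> t + \<phi> (t, b, x)"
proof
  assume eq: "s + \<phi> (s, b, x) = t + \<phi> (t, b, x)"
  have der: "((\<lambda>z. z + \<phi> (z, b, x)) has_field_derivative 1 + D\<phi> (z, b, x) (1, 0, 0)) (at z)"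
    if "s \<le> z" "z \<le> t" for z
    using deriv_first[OF seg[OF that]] by (intro DERIV_add DERIV_ident)
  obtain z where z: "s < z" "z < t" "t + \<phi> (t, b, x) - (s + \<phi> (s, b, x)) =
      (t - s) * (1 + D\<phi> (z, b, x) (1, 0, 0))"
    using MVT2[OF assms(1) der] by blast
  then have "1 + D\<phi> (z, b, x) (1, 0, 0) = 0" using eq assms(1) by simp
  with nonvanishing[OF seg, of z] z show False by simp
qed

text \<open>\<open>coords\<close> and \<open>foot\<close> of a point differ only in the first entry,
  so the segment joining them is a real interval with \<open>b\<close> and \<open>x\<close>
  frozen.\<close>

lemma slide_dom_iff:
  "((x, s), (a, b)) \<in> slide_dom \<longleftrightarrow> (\<forall>z\<in>closed_segment a s. (z, b, x) \<in> U)"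
proof -
  have "closed_segment (a, b, x) (s, b, x) = (\<lambda>z. (z, b, x)) ` closed_segment a s"
    by (force simp: closed_segment_def algebra_simps image_iff)
  then show ?thesis by (auto simp: slide_dom_def coords_def foot_def)
qed

lemma inj_on_slide: "inj_on slide slide_dom"
proof (rule inj_onI)
  fix r r' assume dom: "r \<in> slide_dom" "r' \<in> slide_dom" and eq: "slide r = slide r'"
  obtain x s a b where r: "r = ((x, s), (a, b))" by (metis prod.exhaust)
  obtain t where r': "r' = ((x, t), (a, b))"
    using eq by (cases r'; cases "fst r'") (auto simp: r slide_def)
  \<comment> \<open>Both admissible intervals start at \<open>a\<close>, so together they cover the
    interval between \<open>s\<close> and \<open>t\<close>. This makes the mean value argument
    available without convexity of \<open>U\<close>.\<close>
  have *: "(z, b, x) \<in> U" if "min s t \<le> z" "z \<le> max s t" for z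
  proof -
    have "z \<in> closed_segment a s \<or> z \<in> closed_segment a t"
      using that by (auto simp: closed_segment_eq_real_ivl)
    then show ?thesis using dom by (auto simp: r r' slide_dom_iff)
  qed
  have "s + \<phi> (s, b, x) = t + \<phi> (t, b, x)"
    using eq by (simp add: r r' slide_def foot_def)
  then have "s = t"
    using slide_inj_aux[of s t b x] slide_inj_aux[of t s b x] * by (cases s t rule: linorder_cases) auto
  then show "r = r'" by (simp add: r r')
qed

lemma continuous_on_slide: "continuous_on slide_dom slide"
  by (intro continuous_at_imp_continuous_on ballI has_derivative_continuous[OF slide_has_derivative])

lemma open_slide_image: "open (slide ` slide_dom)"
  using invariance_of_domain[OF continuous_on_slide open_slide_dom inj_on_slide] .

section \<open>The inverse of sliding and its differential\<close>

lemma unslide_slide: "r \<in> slide_dom \<Longrightarrow> unslide (slide r) = r"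
  by (simp add: unslide_def inv_into_f_f inj_on_slide)

lemma unslide_in_slide_dom: "p \<in> slide ` slide_dom \<Longrightarrow> unslide p \<in> slide_dom"
  by (auto simp: unslide_slide)

lemma unslide_has_derivative:
  assumes "p \<in> slide ` slide_dom"
  shows "(unslide has_derivative unslide_deriv (unslide p)) (at p)"
proof -
  obtain r where r: "r \<in> slide_dom" "p = slide r" using assms by auto
  \<comment> \<open>\<open>unslide_deriv r\<close> is a right inverse of the differential of
    \<open>slide\<close> at \<open>r\<close>, which is what the inverse function theorem below asks
    for.\<close>
  have "(\<lambda>v. ((fst (fst v), snd (fst v) + D\<phi> (foot r) (foot v)), snd v)) (unslide_deriv r v) = v" for v
  proof -
    have "snd (fst (unslide_deriv r v)) * (1 + D\<phi> (foot r) (1, 0, 0)) =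
      snd (fst v) - D\<phi> (foot r) (0, snd (snd v), fst (fst v))"
      using nonvanishing[OF foot_in_U[OF r(1)]] by (simp add: unslide_deriv_def)
    moreover have "D\<phi> (foot r) (foot (unslide_deriv r v)) =
      snd (fst (unslide_deriv r v)) * D\<phi> (foot r) (1, 0, 0) + D\<phi> (foot r) (0, snd (snd v), fst (fst v))"
      unfolding foot_def[of "unslide_deriv r v"]
      by (subst D\<phi>_first[OF foot_in_U[OF r(1)]]) (simp add: unslide_deriv_def)
    ultimately have "snd (fst (unslide_deriv r v)) + D\<phi> (foot r) (foot (unslide_deriv r v)) = snd (fst v)"
      by (simp add: algebra_simps)
    then show ?thesis by (simp add: prod_eq_iff) (simp add: unslide_deriv_def)
  qed
  then show ?thesis
    using has_derivative_inverse_strong[OF open_slide_dom r(1) continuous_on_slide unslide_slide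
        slide_has_derivative[OF r(1)], of "unslide_deriv r"] r unslide_slide
    by (simp add: fun_eq_iff)
qed

lemma smooth_unslide: "smooth_on (slide ` slide_dom) unslide"
proof (rule smooth_on_inverse_function[OF open_slide_image])
  show "unslide ` slide ` slide_dom \<subseteq> slide_dom" using unslide_slide by auto
  show "(unslide has_derivative unslide_deriv (unslide p)) (at p)" if "p \<in> slide ` slide_dom" for p
    using unslide_has_derivative that .
  have D: "smooth_on slide_dom (\<lambda>r. D\<phi> (foot r) w)" for w
    by (rule smooth_on_compose[OF open_slide_dom smooth_on_frechet_derivative[OF smooth_\<phi>]])
       (auto intro: smooth_on_linear bounded_linear_foot open_slide_dom foot_in_U)
  have mD: "smooth_on slide_dom (\<lambda>r. - D\<phi> (foot r) w)" for w
    using smooth_on_mult[OF open_slide_dom smooth_on_const[OF open_slide_dom, of "-1"] D] by simp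
  show "smooth_on slide_dom (\<lambda>r. unslide_deriv r v)" for v
    unfolding unslide_deriv_def
    by (intro smooth_on_Pair smooth_on_mult smooth_on_add smooth_on_inverse smooth_on_const
        D mD open_slide_dom nonvanishing foot_in_U)
qed

text \<open>Implicit differentiation of s + \<phi>(s, b, x) = y in b, with x and y fixed, gives
  ds/db = -\<phi>_b / (1 + \<phi>_a). The foot therefore moves with a velocity proportional to
  \<open>Y\<close>.\<close>

lemma foot_unslide_deriv_b:
  assumes "foot r \<in> U"
  shows "foot (unslide_deriv r ((0, 0), (0, h))) =
    (h * inverse (1 + partial_a \<phi> (foot r))) *\<^sub>R field_Y \<phi> (foot r)"
proof -
  interpret linear "D\<phi> (foot r)" by (rule linear_D\<phi>[OF assms])
  have "D\<phi> (foot r) (0, h, 0) = D\<phi> (foot r) (0, 1, 0) * h"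
    using scaleR[of h "(0, 1, 0)"] by simp
  then show ?thesis
    using nonvanishing[OF assms] assms
    by (simp add: foot_def[of "((_, _), _)"] unslide_deriv_def field_Y_def
        partial_a_eq partial_b_eq)
qed

text \<open>The equation s + \<phi>(s, b, x) = y that determines the foot does not involve
  a.\<close>

lemma foot_unslide_deriv_a:
  assumes "foot r \<in> U"
  shows "foot (unslide_deriv r ((0, 0), (h, 0))) = 0"
  using linear_0[OF linear_D\<phi>[OF assms]]
  by (simp add: foot_def[of "((_, _), _)"] unslide_deriv_def zero_prod_def)

lemma slide_coords: "coords (slide r) = coords r"
  by (simp add: coords_eq slide_def)

text \<open>A point of the hypersurface is its own foot: take s = a, where the segment degenerates
  to a point of \<open>U\<close>.\<close>

lemma hypersurface_slide:
  assumes "p \<in> hypersurface U \<phi>"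
  shows "p \<in> slide ` slide_dom" "foot (unslide p) = coords p"
proof -
  obtain x y a b where p: "p = ((x, y), (a, b))" "(a, b, x) \<in> U" "y = a + \<phi> (a, b, x)"
    using assms by (auto simp: hypersurface_def)
  have r: "((x, a), (a, b)) \<in> slide_dom" "p = slide ((x, a), (a, b))"
    using p by (auto simp: slide_dom_iff slide_def foot_def)
  then show "p \<in> slide ` slide_dom" by blast
  have "unslide p = ((x, a), (a, b))" using unslide_slide r by metis
  then show "foot (unslide p) = coords p" by (simp add: p(1) foot_def coords_def)
qed

text \<open>\<open>H\<close> is constant along the \<open>a\<close>-direction because \<open>foot \<circ> unslide\<close> is, and
  along the \<open>b\<close>-direction because there \<open>foot \<circ> unslide\<close> moves along \<open>Y\<close>.\<close>

lemma slide_extension_derivs: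
  assumes H: "smooth_on U H" and Y: "\<And>u. u \<in> U \<Longrightarrow> frechet_derivative H (at u) (field_Y \<phi> u) = 0"
    and p: "((x, y), (a, b)) \<in> slide ` slide_dom"
  shows "((\<lambda>t. H (foot (unslide ((x, y), (t, b))))) has_vector_derivative 0) (at a)"
    and "((\<lambda>t. H (foot (unslide ((x, y), (a, t))))) has_vector_derivative 0) (at b)"
proof -
  define r where "r = unslide ((x, y), (a, b))"
  have r: "foot r \<in> U" using foot_in_U unslide_in_slide_dom[OF p] by (simp add: r_def)
  have "(unslide has_derivative unslide_deriv r) (at ((x, y), (a, b)))"
    using unslide_has_derivative[OF p] by (simp add: r_def)
  then have "((\<lambda>q. foot (unslide q)) has_derivative (\<lambda>v. foot (unslide_deriv r v))) (at ((x, y), (a, b)))"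
    by (rule bounded_linear.has_derivative[OF bounded_linear_foot])
  moreover have DH: "(H has_derivative frechet_derivative H (at (foot r))) (at (foot r))"
    using smooth_on_has_derivative[OF H r] .
  ultimately have D: "((\<lambda>q. H (foot (unslide q))) has_derivative
      (\<lambda>v. frechet_derivative H (at (foot r)) (foot (unslide_deriv r v)))) (at ((x, y), (a, b)))"
    using has_derivative_compose by (fastforce simp: r_def)
  interpret linear "frechet_derivative H (at (foot r))" using DH by (rule has_derivative_linear)
  have "((\<lambda>t. ((x, y), (t, b))) has_derivative (\<lambda>h. ((0, 0), (h, 0)))) (at a)"
    by (auto intro!: derivative_eq_intros simp: zero_prod_def)
  from has_derivative_compose[OF this D]
  show "((\<lambda>t. H (foot (unslide ((x, y), (t, b))))) has_vector_derivative 0) (at a)"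
    by (simp add: has_vector_derivative_def foot_unslide_deriv_a[OF r] zero)
  have "((\<lambda>t. ((x, y), (a, t))) has_derivative (\<lambda>h. ((0, 0), (0, h)))) (at b)"
    by (auto intro!: derivative_eq_intros simp: zero_prod_def)
  from has_derivative_compose[OF this D]
  show "((\<lambda>t. H (foot (unslide ((x, y), (a, t))))) has_vector_derivative 0) (at b)"
    by (simp add: has_vector_derivative_def foot_unslide_deriv_b[OF r] scaleR Y[OF r])
qed

text \<open>\<open>coords\<close> forgets y, and varying x moves the coordinates along
  \<open>X\<close>, which annihilates \<open>H\<close>.\<close>

lemma coords_extension_derivs:
  assumes H: "smooth_on U H" and X: "\<And>u. u \<in> U \<Longrightarrow> frechet_derivative H (at u) (field_X \<phi> u) = 0"
    and p: "coords ((x, y), (a, b)) \<in> U"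
  shows "((\<lambda>t. H (coords ((t, y), (a, b)))) has_vector_derivative 0) (at x)"
    and "((\<lambda>t. H (coords ((x, t), (a, b)))) has_vector_derivative 0) (at y)"
proof -
  have DH: "(H has_derivative frechet_derivative H (at (a, b, x))) (at (a, b, x))"
    using smooth_on_has_derivative[OF H] p by (simp add: coords_def)
  interpret linear "frechet_derivative H (at (a, b, x))" using DH by (rule has_derivative_linear)
  have "frechet_derivative H (at (a, b, x)) (0, 0, h) = 0" for h
    using scaleR[of h "(0, 0, 1)"] X[of "(a, b, x)"] p by (simp add: field_X_def coords_def)
  moreover have "((\<lambda>t. (a, b, t)) has_derivative (\<lambda>h. (0, 0, h))) (at x)"
    by (auto intro!: derivative_eq_intros)
  note has_derivative_compose[OF this DH]
  ultimately show "((\<lambda>t. H (coords ((t, y), (a, b)))) has_vector_derivative 0) (at x)"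
    by (simp add: has_vector_derivative_def coords_def)
  show "((\<lambda>t. H (coords ((x, t), (a, b)))) has_vector_derivative 0) (at y)"
    by (simp add: coords_def)
qed

end

section \<open>Construction of the para-holomorphic extension\<close>

theorem proposition4:
  fixes U U' :: "R3 set" and \<phi> \<phi>' :: "R3 \<Rightarrow> real" and F :: "R4 \<Rightarrow> R4"
  assumes "embedded_para_CR U \<phi>"
    and "embedded_para_CR U' \<phi>'"
    and "para_CR_map U \<phi> U' \<phi>' F"
  shows "\<exists>N N' Ft. hypersurface U \<phi> \<subseteq> N \<and> hypersurface U' \<phi>' \<subseteq> N' \<and>
           para_holomorphic N N' Ft \<and> (\<forall>p\<in>hypersurface U \<phi>. Ft p = F p)"
proof -
  interpret M: para_CR U \<phi> using assms(1) by unfold_locales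
  interpret M': para_CR U' \<phi>' using assms(2) by unfold_locales
  define G where "G = coords \<circ> F \<circ> param \<phi>"
  have smooth_G: "smooth_on U G" and F_in: "F ` hypersurface U \<phi> \<subseteq> hypersurface U' \<phi>'"
    using assms(3) by (auto simp: para_CR_map_def G_def)
  obtain l m where DG: "\<And>u. u \<in> U \<Longrightarrow>
      frechet_derivative G (at u) (field_X \<phi> u) = l u *\<^sub>R field_X \<phi>' (G u) \<and>
      frechet_derivative G (at u) (field_Y \<phi> u) = m u *\<^sub>R field_Y \<phi>' (G u)"
    using assms(3) unfolding para_CR_map_def G_def o_apply by blast
  have G_in: "G u \<in> U'" if "u \<in> U" for u
    using M.param_in_hypersurface[OF that] F_in M'.coords_in_U unfolding G_def o_apply by blast
  have F_eq: "param \<phi>' (G (coords p)) = F p" if "p \<in> hypersurface U \<phi>" for p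
  proof -
    have "F p \<in> hypersurface U' \<phi>'" using that F_in by blast
    then show ?thesis using M.param_coords[OF that] M'.param_coords by (simp add: G_def)
  qed
  \<comment> \<open>\<open>P\<close> is F in the source coordinates. Writing it through
    \<open>param \<phi>'\<close> reduces its smoothness to that of \<open>G\<close>, where the
    hypothesis on F is stated.\<close>
  define P where "P = (\<lambda>u. param \<phi>' (G u))"
  have smooth_P: "smooth_on U P"
    unfolding P_def using smooth_on_compose[OF M.open_U M'.smooth_param smooth_G] G_in by blast
  have "(P has_derivative (\<lambda>v. (\<lambda>w. ((snd (snd w), fst w + M'.D\<phi> (G u) w), (fst w, fst (snd w))))
      (frechet_derivative G (at u) v))) (at u)" if "u \<in> U" for u
    unfolding P_def
    using has_derivative_compose[OF smooth_on_has_derivative[OF smooth_G that]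
        M'.param_has_derivative[OF G_in[OF that]]] .
  note DP = bounded_linear.has_derivative[OF bounded_linear_fst this]
    bounded_linear.has_derivative[OF bounded_linear_snd this]
  \<comment> \<open>The differential of \<open>G\<close> maps \<open>Y\<close> to a multiple of the
    target \<open>Y'\<close>, which has no x'-component and annihilates y' by
    \<open>M'.D\<phi>_field_Y\<close>.\<close>
  have Y0: "frechet_derivative (\<lambda>u. fst (P u)) (at u) (field_Y \<phi> u) = 0" if "u \<in> U" for u
  proof -
    interpret linear "M'.D\<phi> (G u)" by (rule M'.linear_D\<phi>[OF G_in[OF that]])
    have "fst (m u *\<^sub>R field_Y \<phi>' (G u)) + M'.D\<phi> (G u) (m u *\<^sub>R field_Y \<phi>' (G u)) =
        m u * (fst (field_Y \<phi>' (G u)) + M'.D\<phi> (G u) (field_Y \<phi>' (G u)))"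
      by (simp add: scaleR distrib_left)
    then have "fst (m u *\<^sub>R field_Y \<phi>' (G u)) + M'.D\<phi> (G u) (m u *\<^sub>R field_Y \<phi>' (G u)) = 0"
      using M'.D\<phi>_field_Y[OF G_in[OF that]] by simp
    moreover have "snd (snd (m u *\<^sub>R field_Y \<phi>' (G u))) = 0" by (simp add: field_Y_def)
    ultimately show ?thesis
      unfolding frechet_derivative_at[OF DP(1)[OF that], symmetric] fst_conv
        conjunct2[OF DG[OF that]] by (simp only: zero_prod_def)
  qed
  \<comment> \<open>Here the image is a multiple of \<open>X'\<close>, whose a'- and b'-components
    are zero.\<close>
  have X0: "frechet_derivative (\<lambda>u. snd (P u)) (at u) (field_X \<phi> u) = 0" if "u \<in> U" for u
    unfolding frechet_derivative_at[OF DP(2)[OF that], symmetric]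
      snd_conv conjunct1[OF DG[OF that]] by (simp add: field_X_def zero_prod_def)
  have smooth_P1: "smooth_on U (\<lambda>u. fst (P u))" and smooth_P2: "smooth_on U (\<lambda>u. snd (P u))"
    by (rule smooth_on_compose[OF M.open_U smooth_on_linear[OF bounded_linear_fst open_UNIV] smooth_P],
        simp, rule smooth_on_compose[OF M.open_U smooth_on_linear[OF bounded_linear_snd open_UNIV] smooth_P],
        simp)
  define N where "N = M.slide ` M.slide_dom"
  \<comment> \<open>The components x', y' are read off at the foot point, and a', b' at the
    coordinates obtained by dropping y.\<close>
  define Ft where "Ft = (\<lambda>p. (fst (P (M.foot (M.unslide p))), snd (P (coords p))))"
  have "open N" using M.open_slide_image by (simp add: N_def)
  have foot: "M.foot (M.unslide p) \<in> U" if "p \<in> N" for p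
    using that M.foot_in_U M.unslide_in_slide_dom by (simp add: N_def)
  have coords: "coords p \<in> U" if "p \<in> N" for p
    using that M.slide_coords M.slide_dom_coords_in_U by (auto simp: N_def)
  have "smooth_on N (\<lambda>p. M.foot (M.unslide p))"
    using smooth_on_compose[OF \<open>open N\<close> smooth_on_linear[OF M.bounded_linear_foot open_UNIV]]
      M.smooth_unslide by (simp add: N_def)
  then have "smooth_on N (\<lambda>p. fst (P (M.foot (M.unslide p))))"
    by (rule smooth_on_compose[OF \<open>open N\<close> smooth_P1]) (use foot in blast)
  moreover have "smooth_on N (\<lambda>p. snd (P (coords p)))"
    by (rule smooth_on_compose[OF \<open>open N\<close> smooth_P2
          smooth_on_linear[OF M.bounded_linear_coords \<open>open N\<close>]]) (use coords in blast)
  ultimately have "smooth_on N Ft"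
    unfolding Ft_def by (rule smooth_on_Pair[OF \<open>open N\<close>])
  \<comment> \<open>All of R^4 serves as the neighbourhood of the target hypersurface.\<close>
  then have "para_holomorphic N UNIV Ft"
    unfolding para_holomorphic_def Ft_def fst_conv snd_conv
    by (intro conjI allI impI \<open>open N\<close> open_UNIV subset_UNIV
        M.slide_extension_derivs[OF smooth_P1 Y0] M.coords_extension_derivs[OF smooth_P2 X0 coords])
       (simp_all add: N_def)
  moreover have "hypersurface U \<phi> \<subseteq> N"
    using M.hypersurface_slide(1) by (auto simp: N_def)
  \<comment> \<open>On the hypersurface the foot coincides with \<open>coords p\<close>, so both
    halves of \<open>Ft\<close> come from the same value of \<open>P\<close>.\<close>
  moreover have "Ft p = F p" if "p \<in> hypersurface U \<phi>" for p
    using M.hypersurface_slide(2)[OF that] F_eq[OF that] by (simp add: Ft_def P_def)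
  ultimately show ?thesis by blast
qed

end
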